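(* Let $D$ be a unicyclic digraph with a directed cycle of length $2\ell$ and with bipartition $U\cup V$ of its vertex set. If $q\ge 3$ is an odd integer, then there exist $q$-kernels $Q_U\subseteq U$ and $Q_V\subseteq V$ of $D$ such that \[ |Q_U|+|Q_V|\le 2\cdot\frac{\lceil \ell/(q+1)\rceil}{\ell}\,|V(D)| . \]
   Context: All digraphs are finite and have no loops and no multiple (parallel) arcs; directed $2$-cycles are allowed. $V(D)$ denotes the vertex set of $D$. A digraph is unicyclic if every vertex has in-degree exactly $1$ and its underlying graph is connected (such a digraph contains exactly one directed cycle). That $D$ has bipartition $U\cup V$ means that $V(D)$ is the disjoint union of $U$ and $V$ and every arc of $D$ has one end in $U$ and the other in $V$. For vertices $u,v$, $\operatorname{dist}_D(u,v)$ is the length of a shortest directed path from $u$ to $v$ ($\infty$ if none exists), and for $S\subseteq V(D)$, $\operatorname{dist}_D(S,v)=\min_{s\in S}\operatorname{dist}_D(s,v)$. A set $S\subseteq V(D)$ is independent if there is no arc between any two vertices of $S$. A $q$-kernel of $D$ is an independent set $K\subseteq V(D)$ such that $\operatorname{dist}_D(K,v)\le q$ for every $v\in V(D)$. *)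

theory Defs
  imports "Graph_Theory.Graph_Theory"
begin

text \<open>
  The locale \<^locale>\<open>digraph\<close> of the library describes finite digraphs without loops and
  without parallel arcs; antiparallel arcs (directed 2-cycles) are allowed.
  Here \<open>connected\<close> is graph connectivity of the underlying (symmetrised) graph, not
  topological connectedness; it entails that there is at least one vertex.
\<close>

definition unicyclic :: "('a, 'b) pre_digraph \<Rightarrow> bool" where
  "unicyclic D \<longleftrightarrow>
     digraph D \<and> (\<forall>v \<in> verts D. in_degree D v = 1) \<and> Digraph_Component.connected D"

definition bipartition :: "('a, 'b) pre_digraph \<Rightarrow> 'a set \<Rightarrow> 'a set \<Rightarrow> bool" where
  "bipartition D U V \<longleftrightarrow>
     verts D = U \<union> V \<and> U \<inter> V = {} \<and>
     (\<forall>e \<in> arcs D. tail D e \<in> U \<and> head D e \<in> V \<or> tail D e \<in> V \<and> head D e \<in> U)"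

text \<open>
  \<open>wf_digraph.\<mu>\<close> is the infimum of the costs of the directed walks from one vertex to
  another; with unit arc weights the cost is the length, and the value is \<open>\<infinity>\<close> if there is
  no such walk.
\<close>

definition distance :: "('a, 'b) pre_digraph \<Rightarrow> 'a \<Rightarrow> 'a \<Rightarrow> ereal" where
  "distance D u v = wf_digraph.\<mu> D (\<lambda>_. 1) u v"

text \<open>For finite nonempty \<open>S\<close> the infimum is a minimum; for empty \<open>S\<close> it is \<open>\<infinity>\<close>.\<close>

definition set_distance :: "('a, 'b) pre_digraph \<Rightarrow> 'a set \<Rightarrow> 'a \<Rightarrow> ereal" where
  "set_distance D S v = (INF s\<in>S. distance D s v)"

definition independent_set :: "('a, 'b) pre_digraph \<Rightarrow> 'a set \<Rightarrow> bool" where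
  "independent_set D S \<longleftrightarrow> S \<subseteq> verts D \<and> (\<forall>u \<in> S. \<forall>v \<in> S. \<not> u \<rightarrow>\<^bsub>D\<^esub> v)"

definition q_kernel :: "('a, 'b) pre_digraph \<Rightarrow> nat \<Rightarrow> 'a set \<Rightarrow> bool" where
  "q_kernel D q K \<longleftrightarrow>
     independent_set D K \<and> (\<forall>v \<in> verts D. set_distance D K v \<le> ereal (real q))"

end

theory Submission
  imports Defs "HOL-Number_Theory.Cong"
begin

text \<open>
  In a unicyclic digraph every vertex has exactly one in-neighbour, its \<^emph>\<open>parent\<close>, so a walk
  ending in \<open>v\<close>, read backwards, climbs through \<open>parent v\<close>, \<open>parent (parent v)\<close>, and so on; by
  connectedness every such climb enters the cycle.  Counting the steps that it takes to climb to a chosen vertex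
  of the cycle gives levels modulo the cycle length \<open>2 * l\<close> that drop by one from a vertex to its
  parent (lemma \<open>parent_level\<close>).  The grandparent of a vertex lies on the same side of the
  bipartition, so halving the levels gives each side levels modulo \<open>l\<close> that drop by one from a
  vertex to its grandparent.

  Write \<open>q + 1 = 2 * m\<close>.  On one side \<open>W\<close>, take the vertices whose half level, shifted by some
  constant \<open>t\<close> and reduced to \<open>{..<l}\<close>, is a multiple of \<open>m\<close>.  A vertex of \<open>W\<close> meets such a vertex
  after climbing at most \<open>m - 1\<close> grandparents, that is, at most \<open>q - 1\<close> arcs; a vertex of the other
  side first climbs to its parent in \<open>W\<close>.  So each of the \<open>l\<close> shifts gives a \<open>q\<close>-kernel inside \<open>W\<close>
  (lemma \<open>residue_class_is_q_kernel\<close>).  Below \<open>l\<close> there are at most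
  \<open>2 * \<lceil>l / (q + 1)\<rceil>\<close> multiples of \<open>m\<close>, so each vertex of \<open>W\<close> belongs to at most that many of
  the \<open>l\<close> kernels.  By averaging, some shift gives a kernel with at most
  \<open>2 * \<lceil>l / (q + 1)\<rceil> / l * card W\<close> vertices.  Adding the bounds for the two sides yields the claim.
\<close>

section \<open>Levels along the iterates of a function\<close>

text \<open>
  The level of \<open>v\<close> is the number of steps to the first visit of \<open>c\<close>.  At \<open>c\<close> itself it jumps from
  \<open>0\<close> to \<open>N - 1\<close>, which the congruence absorbs; this needs \<open>N\<close> to be the least period of \<open>c\<close>.
\<close>

lemma first_visit_level:
  fixes p :: "'a \<Rightarrow> 'a"
  assumes "N > 0" and period: "(p ^^ N) c = c"
    and least: "\<And>i. 0 < i \<Longrightarrow> i < N \<Longrightarrow> (p ^^ i) c \<noteq> c"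
    and visits: "\<And>v. v \<in> A \<Longrightarrow> \<exists>i. (p ^^ i) v = c"
  obtains h :: "'a \<Rightarrow> nat" where "\<And>v. v \<in> A \<Longrightarrow> Suc (h (p v)) mod N = h v mod N"
proof
  let ?h = "\<lambda>v. LEAST i. (p ^^ i) v = c"
  fix v assume "v \<in> A"
  show "Suc (?h (p v)) mod N = ?h v mod N"
  proof (cases "v = c")
    case True
    have "?h (p c) = N - 1"
    proof (rule Least_equality)
      show "(p ^^ (N - 1)) (p c) = c"
        using period \<open>N > 0\<close> by (cases N) (simp_all add: funpow_swap1)
    next
      fix i assume "(p ^^ i) (p c) = c"
      then have "(p ^^ Suc i) c = c" by (simp add: funpow_swap1)
      then show "N - 1 \<le> i" using least[of "Suc i"] by fastforce
    qed
    moreover have "?h c = 0" by (rule Least_equality) simp_all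
    ultimately show ?thesis using True \<open>N > 0\<close> by simp
  next
    case False
    from visits[OF \<open>v \<in> A\<close>] obtain i where "(p ^^ i) v = c" by blast
    then have "?h v = Suc (LEAST i. (p ^^ Suc i) v = c)"
      using False by (intro Least_Suc) simp_all
    then show ?thesis by (simp add: funpow_swap1)
  qed
qed

lemma halved_level:
  fixes h :: "'a \<Rightarrow> nat"
  assumes step: "\<And>v. v \<in> A \<Longrightarrow> Suc (h (p v)) mod (2 * l) = h v mod (2 * l)"
    and "v \<in> A" "p v \<in> A"
  shows "Suc (h (p (p v)) div 2) mod l = (h v div 2) mod l"
proof -
  have "Suc (Suc (h (p (p v)))) mod (2 * l) = Suc (h (p v)) mod (2 * l)"
    using step[OF \<open>p v \<in> A\<close>] by (metis mod_Suc_eq)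
  also have "\<dots> = h v mod (2 * l)" using step[OF \<open>v \<in> A\<close>] .
  finally have eq: "(h (p (p v)) + 2) mod (2 * l) = h v mod (2 * l)" by simp
  have half: "(a mod (2 * l)) div 2 = (a div 2) mod l" for a :: nat
    by (simp add: mod_mult2_eq)
  have "((h (p (p v)) + 2) div 2) mod l = (h v div 2) mod l"
    using eq half by metis
  then show ?thesis by simp
qed

text \<open>
  A level in \<open>{..<l}\<close> that counts down by one meets the next lower multiple of \<open>m\<close> before it can
  wrap around: \<open>0\<close> is itself a multiple of \<open>m\<close>, so the jump from \<open>0\<close> to \<open>l - 1\<close> is never crossed.
\<close>

lemma descent_to_multiple:
  fixes x :: "'a \<Rightarrow> nat"
  assumes closed: "\<And>v. v \<in> A \<Longrightarrow> r v \<in> A"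
    and small: "\<And>v. v \<in> A \<Longrightarrow> x v < l"
    and step: "\<And>v. v \<in> A \<Longrightarrow> Suc (x (r v)) mod l = x v"
    and "v \<in> A"
  shows "(r ^^ (x v mod m)) v \<in> A \<and> m dvd x ((r ^^ (x v mod m)) v)"
  using \<open>v \<in> A\<close>
proof (induction "x v mod m" arbitrary: v)
  case 0
  then show ?case by (simp add: dvd_eq_mod_eq_0)
next
  case (Suc k)
  have "x v \<noteq> 0" using Suc.hyps(2) by (metis mod_0 nat.distinct(1))
  then have x: "x v = Suc (x (r v))"
    using step[OF Suc.prems] small[OF closed[OF Suc.prems]] by (auto simp: mod_Suc split: if_splits)
  then have "x (r v) mod m = k"
    using Suc.hyps(2) by (metis mod_Suc nat.inject nat.distinct(1))
  with Suc.hyps(1)[of "r v"] closed[OF Suc.prems] Suc.hyps(2)[symmetric]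
  show ?case by (simp add: funpow_swap1)
qed

section \<open>Averaging over the shifts\<close>

text \<open>
  The interval \<open>{..<l}\<close> is covered by \<open>2 * k\<close> blocks of length \<open>m\<close>, and the only multiple of \<open>m\<close> in
  a block is its first element.
\<close>

lemma card_multiples_le:
  fixes l m k :: nat
  assumes "l \<le> 2 * m * k"
  shows "card {x. x < l \<and> m dvd x} \<le> 2 * k"
proof -
  have "{x. x < l \<and> m dvd x} \<subseteq> (\<lambda>i. m * i) ` {..<2 * k}"
  proof
    fix x assume "x \<in> {x. x < l \<and> m dvd x}"
    then obtain i where "x = m * i" "m * i < l" by (auto simp: dvd_def)
    moreover have "l \<le> m * (2 * k)" using assms by (simp add: mult.assoc mult.left_commute)
    ultimately have "m * i < m * (2 * k)" by linarith
    then have "i < 2 * k" by simp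
    with \<open>x = m * i\<close>
    show "x \<in> (\<lambda>i. m * i) ` {..<2 * k}" by blast
  qed
  then have "card {x. x < l \<and> m dvd x} \<le> card {..<2 * k}"
    by (meson card_image_le card_mono finite_imageI finite_lessThan le_trans)
  then show ?thesis by simp
qed

lemma card_shifts_le:
  fixes a l m :: nat
  assumes "l > 0"
  shows "card {t. t < l \<and> m dvd (a + t) mod l} \<le> card {x. x < l \<and> m dvd x}"
proof (rule card_inj_on_le)
  show "inj_on (\<lambda>t. (a + t) mod l) {t. t < l \<and> m dvd (a + t) mod l}"
  proof (rule inj_onI)
    fix s t assume *: "s \<in> {t. t < l \<and> m dvd (a + t) mod l}" "t \<in> {t. t < l \<and> m dvd (a + t) mod l}"
      and "(a + s) mod l = (a + t) mod l"
    then have "s mod l = t mod l" by (metis cong_add_lcancel_nat cong_def)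
    with * show "s = t" by simp
  qed
qed (use assms in auto)

lemma small_residue_class:
  fixes g :: "'a \<Rightarrow> nat"
  assumes "finite W" and "l > 0" and "l \<le> 2 * m * k"
  obtains t where "l * card {v \<in> W. m dvd (g v + t) mod l} \<le> 2 * k * card W"
proof -
  let ?Q = "\<lambda>t. {v \<in> W. m dvd (g v + t) mod l}"
  have "(\<Sum>t<l. card (?Q t)) = (\<Sum>t<l. \<Sum>v\<in>W. if m dvd (g v + t) mod l then 1 else 0)"
    using assms(1) by (simp add: sum.If_cases Int_def)
  also have "\<dots> = (\<Sum>v\<in>W. \<Sum>t<l. if m dvd (g v + t) mod l then 1 else 0)"
    by (rule sum.swap)
  also have "\<dots> = (\<Sum>v\<in>W. card {t. t < l \<and> m dvd (g v + t) mod l})"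
    by (simp add: sum.If_cases Int_def)
  also have "\<dots> \<le> (\<Sum>v\<in>W. 2 * k)"
    by (intro sum_mono order_trans[OF card_shifts_le card_multiples_le] assms)
  finally have total: "(\<Sum>t<l. card (?Q t)) \<le> 2 * k * card W" by (simp add: mult.commute)
  obtain t where "t < l" and min: "\<And>s. s < l \<Longrightarrow> card (?Q t) \<le> card (?Q s)"
    using ex_min_if_finite[of "(\<lambda>s. card (?Q s)) ` {..<l}"] \<open>l > 0\<close>
    by (auto simp: not_less)
  have "l * card (?Q t) = (\<Sum>s<l. card (?Q t))" by simp
  also have "\<dots> \<le> (\<Sum>s<l. card (?Q s))" using min by (intro sum_mono) simp
  finally show ?thesis using total that by (meson le_trans)
qed

section \<open>Parents in a unicyclic digraph\<close>

definition parent :: "('a, 'b) pre_digraph \<Rightarrow> 'a \<Rightarrow> 'a" where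
  "parent D v = tail D (THE e. e \<in> arcs D \<and> head D e = v)"

lemma unicyclic_wf: "unicyclic D \<Longrightarrow> wf_digraph D"
  by (simp add: unicyclic_def digraph_def fin_digraph_def)

lemma unicyclic_finite: "unicyclic D \<Longrightarrow> finite (verts D)"
  by (simp add: unicyclic_def digraph_def fin_digraph_def fin_digraph_axioms_def)

lemma unicyclic_ex1_in_arc:
  assumes "unicyclic D" "v \<in> verts D"
  shows "\<exists>!e. e \<in> arcs D \<and> head D e = v"
proof -
  have "card (in_arcs D v) = 1"
    using assms by (auto simp: unicyclic_def in_degree_def)
  then obtain e where "in_arcs D v = {e}" by (auto simp: card_1_singleton_iff)
  then have "e' \<in> arcs D \<and> head D e' = v \<longleftrightarrow> e' = e" for e'
    by (auto simp: in_arcs_def set_eq_iff)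
  then show ?thesis by simp
qed

lemma parent_head:
  assumes "unicyclic D" "e \<in> arcs D"
  shows "parent D (head D e) = tail D e"
proof -
  have "head D e \<in> verts D" using assms by (simp add: unicyclic_wf wf_digraph.head_in_verts)
  from the1_equality[OF unicyclic_ex1_in_arc[OF assms(1) this]] assms(2)
  show ?thesis by (simp add: parent_def)
qed

lemma in_arc_from_parent:
  assumes "unicyclic D" "v \<in> verts D"
  obtains e where "e \<in> arcs D" "head D e = v" "tail D e = parent D v"
  using unicyclic_ex1_in_arc[OF assms] parent_head[OF assms(1)] by metis

lemma parent_in_verts:
  assumes "unicyclic D" "v \<in> verts D"
  shows "parent D v \<in> verts D"
  using in_arc_from_parent[OF assms] unicyclic_wf[OF assms(1)] wf_digraph.tail_in_verts by metis

lemma funpow_parent_in_verts: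
  assumes "unicyclic D" "v \<in> verts D"
  shows "(parent D ^^ i) v \<in> verts D"
  by (induction i) (simp_all add: assms parent_in_verts)

lemma awalk_imp_funpow_parent:
  assumes "unicyclic D" "pre_digraph.awalk D u w v"
  shows "(parent D ^^ length w) v = u"
proof -
  interpret wf_digraph D by (rule unicyclic_wf[OF assms(1)])
  from assms(2) show ?thesis
    by (induction w arbitrary: u) (auto simp: awalk_simps parent_head[OF assms(1)])
qed

lemma awalk_from_funpow_parent:
  assumes "unicyclic D" "v \<in> verts D"
  shows "\<exists>w. pre_digraph.awalk D ((parent D ^^ i) v) w v \<and> length w = i"
proof -
  interpret wf_digraph D by (rule unicyclic_wf[OF assms(1)])
  show ?thesis
  proof (induction i)
    case 0
    show ?case using assms(2) by (simp add: awalk_Nil_iff)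
  next
    case (Suc i)
    then obtain w where w: "awalk ((parent D ^^ i) v) w v" "length w = i" by blast
    obtain e where "e \<in> arcs D" "head D e = (parent D ^^ i) v" "tail D e = (parent D ^^ Suc i) v"
      using in_arc_from_parent[OF assms(1) funpow_parent_in_verts[OF assms]]
      by (metis comp_apply funpow.simps(2))
    with w have "awalk ((parent D ^^ Suc i) v) (e # w) v \<and> length (e # w) = Suc i"
      by (simp add: awalk_Cons_iff)
    then show ?case by blast
  qed
qed

lemma distance_funpow_parent:
  assumes "unicyclic D" "v \<in> verts D"
  shows "distance D ((parent D ^^ i) v) v \<le> ereal (real i)"
proof -
  interpret wf_digraph D by (rule unicyclic_wf[OF assms(1)])
  obtain w where w: "awalk ((parent D ^^ i) v) w v" "length w = i"
    using awalk_from_funpow_parent[OF assms] by blast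
  have "awalk_cost (\<lambda>_. 1) w = real (length w)" for w :: "'b list"
    by (induction w) simp_all
  with min_cost_le_walk_cost[OF w(1), of "\<lambda>_. 1"] w(2) show ?thesis
    by (simp add: distance_def)
qed

text \<open>
  A return to \<open>u\<close> after \<open>0 < i < length c\<close> steps would split the cycle into two closed walks, and
  \<open>u\<close> would be repeated among its vertices.
\<close>

lemma cycle_least_period:
  assumes "unicyclic D" "pre_digraph.cycle D c"
  obtains u where "u \<in> verts D" "(parent D ^^ length c) u = u"
    "\<And>i. 0 < i \<Longrightarrow> i < length c \<Longrightarrow> (parent D ^^ i) u \<noteq> u"
proof -
  interpret wf_digraph D by (rule unicyclic_wf[OF assms(1)])
  from assms(2) obtain u where u: "awalk u c u" and dist: "distinct (tl (awalk_verts u c))"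
    by (auto simp: cycle_def)
  show ?thesis
  proof
    show "u \<in> verts D" using u by (rule awalk_hd_in_verts)
    show "(parent D ^^ length c) u = u" using awalk_imp_funpow_parent[OF assms(1) u] .
    fix i assume i: "0 < i" "i < length c"
    define a b where "a = take (length c - i) c" and "b = drop (length c - i) c"
    have c: "c = a @ b" and b: "length b = i" "b \<noteq> []" and a: "a \<noteq> []"
      using i by (auto simp: a_def b_def)
    show "(parent D ^^ i) u \<noteq> u"
    proof
      assume return: "(parent D ^^ i) u = u"
      from u c have ab: "awalk u a (awlast u a)" "awalk (awlast u a) b u" by auto
      from awalk_imp_funpow_parent[OF assms(1) ab(2)] b return have x: "awlast u a = u" by simp
      have walks: "awalk u a u" "awalk u b u" using ab x by auto
      have "tl (awalk_verts u c) = tl (awalk_verts u a) @ tl (awalk_verts u b)"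
        using awalk_verts_append[of u a b u] u x c by (cases a) auto
      moreover have "u \<in> set (tl (awalk_verts u w))" if "awalk u w u" "w \<noteq> []" for w
      proof -
        from that obtain e es where "w = e # es" "awalk (head D e) es u"
          by (cases w) (auto simp: awalk_Cons_iff)
        then show ?thesis
          using last_in_set[of "awalk_verts (head D e) es"] by simp
      qed
      ultimately show False using dist walks a b(2) by auto
    qed
  qed
qed

text \<open>
  The vertices that climb to \<open>u\<close> are closed under both directions of the arcs: a parent of such a
  vertex is one step ahead on the climb, and \<open>parent u\<close> returns to \<open>u\<close> in \<open>N - 1\<close> steps.
\<close>

lemma climbs_to_periodic_vertex:
  assumes "unicyclic D" "u \<in> verts D" "v \<in> verts D"
    and "N > 0" "(parent D ^^ N) u = u"
  shows "\<exists>i. (parent D ^^ i) v = u"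
proof -
  have "u \<rightarrow>\<^sup>*\<^bsub>with_proj (mk_symmetric D)\<^esub> v"
    using assms by (auto simp: unicyclic_def Digraph_Component.connected_def strongly_connected_def)
  then have "(u, v) \<in> rtrancl_on (verts D) (parcs (mk_symmetric D))"
    by (simp add: reachable_def)
  then show ?thesis
  proof (induction rule: rtrancl_on_induct)
    case base
    show ?case by (rule exI[of _ 0]) simp
  next
    case (step x y)
    then obtain i where i: "(parent D ^^ i) x = u" by blast
    from step obtain e where e: "e \<in> arcs D"
      and "x = tail D e \<and> y = head D e \<or> x = head D e \<and> y = tail D e"
      by (auto simp: parcs_mk_symmetric)
    then consider "parent D y = x" | "parent D x = y"
      using parent_head[OF assms(1) e] by auto
    then show ?case
    proof cases
      case 1
      then have "(parent D ^^ Suc i) y = u" using i by (simp add: funpow_swap1)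
      then show ?thesis by blast
    next
      case 2
      have "(parent D ^^ (i + N)) x = u"
        using i assms(5) by (simp add: add.commute[of i] funpow_add)
      moreover obtain j where "i + N = Suc j" using \<open>N > 0\<close> by (cases "i + N") auto
      ultimately have "(parent D ^^ j) y = u" using 2 by (simp add: funpow_swap1)
      then show ?thesis by blast
    qed
  qed
qed

lemma parent_level:
  assumes "unicyclic D" "pre_digraph.cycle D c"
  obtains h :: "'a \<Rightarrow> nat" where
    "\<And>v. v \<in> verts D \<Longrightarrow> Suc (h (parent D v)) mod length c = h v mod length c"
proof -
  obtain u where u: "u \<in> verts D" "(parent D ^^ length c) u = u"
    "\<And>i. 0 < i \<Longrightarrow> i < length c \<Longrightarrow> (parent D ^^ i) u \<noteq> u"
    using cycle_least_period[OF assms] by blast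
  have "length c > 0" using assms(2) by (auto simp: pre_digraph.cycle_def)
  then show ?thesis
    using first_visit_level[of "length c" "parent D" u "verts D"]
      climbs_to_periodic_vertex[OF assms(1) u(1)] u that by blast
qed

section \<open>Kernels inside one side of the bipartition\<close>

lemma bipartition_sym: "bipartition D U V \<Longrightarrow> bipartition D V U"
  by (auto simp: bipartition_def)

lemma parent_other_side:
  assumes "unicyclic D" "bipartition D U V" "v \<in> verts D"
  shows "parent D v \<in> U \<longleftrightarrow> v \<in> V"
proof -
  obtain e where "e \<in> arcs D" "head D e = v" "tail D e = parent D v"
    using in_arc_from_parent[OF assms(1,3)] .
  then have "parent D v \<in> U \<and> v \<in> V \<or> parent D v \<in> V \<and> v \<in> U"
    using assms(2) by (fastforce simp: bipartition_def)
  moreover have "U \<inter> V = {}" using assms(2) by (simp add: bipartition_def)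
  ultimately show ?thesis by blast
qed

lemma independent_side:
  assumes "bipartition D U V" "Q \<subseteq> U"
  shows "independent_set D Q"
  using assms by (fastforce simp: independent_set_def bipartition_def arcs_ends_conv)

lemma q_kernelI_climb:
  assumes "unicyclic D" "independent_set D Q"
    and climb: "\<And>v. v \<in> verts D \<Longrightarrow> \<exists>i\<le>q. (parent D ^^ i) v \<in> Q"
  shows "q_kernel D q Q"
  unfolding q_kernel_def
proof (intro conjI ballI)
  fix v assume v: "v \<in> verts D"
  then obtain i where i: "i \<le> q" "(parent D ^^ i) v \<in> Q" using climb by blast
  have "distance D ((parent D ^^ i) v) v \<le> ereal (real q)"
    using distance_funpow_parent[OF assms(1) v, of i] i(1) by (simp add: order_trans)
  then show "set_distance D Q v \<le> ereal (real q)"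
    unfolding set_distance_def using i(2) by (rule INF_lower2[rotated])
qed (fact assms(2))

text \<open>
  Inside \<open>U\<close> the climb moves by grandparents, two arcs per unit of the half level, and fewer than \<open>m\<close>
  units suffice.  This costs at most \<open>2 * (m - 1) = q - 1\<close> arcs and leaves one arc for the vertices
  of \<open>V\<close> to reach their parents in \<open>U\<close>.
\<close>

lemma residue_class_is_q_kernel:
  fixes h :: "'a \<Rightarrow> nat"
  assumes D: "unicyclic D" and UV: "bipartition D U V" and "l > 0" and "q + 1 = 2 * m"
    and h: "\<And>v. v \<in> verts D \<Longrightarrow> Suc (h (parent D v)) mod (2 * l) = h v mod (2 * l)"
  shows "q_kernel D q {v \<in> U. m dvd (h v div 2 + t) mod l}"
proof (rule q_kernelI_climb[OF D])
  let ?Q = "{v \<in> U. m dvd (h v div 2 + t) mod l}"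
  let ?x = "\<lambda>v. (h v div 2 + t) mod l"
  let ?r = "parent D ^^ 2"
  have "q > 0" using \<open>q + 1 = 2 * m\<close> by presburger
  show "independent_set D ?Q" by (rule independent_side[OF UV]) blast
  have verts: "verts D = U \<union> V" "U \<inter> V = {}" using UV by (auto simp: bipartition_def)
  have closed: "?r v \<in> U" if "v \<in> U" for v
  proof -
    have v: "v \<in> verts D" using that verts by blast
    have "parent D v \<in> V" using parent_other_side[OF D bipartition_sym[OF UV] v] that by blast
    then have "parent D (parent D v) \<in> U"
      using parent_other_side[OF D UV parent_in_verts[OF D v]] by blast
    then show ?thesis by (simp add: numeral_2_eq_2)
  qed
  have step: "Suc (?x (?r v)) mod l = ?x v" if "v \<in> U" for v
  proof -
    have v: "v \<in> verts D" using that verts by blast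
    have "Suc (h (?r v) div 2) mod l = (h v div 2) mod l"
      using halved_level[of "verts D" h "parent D" l v, OF h v parent_in_verts[OF D v]]
      by (simp add: numeral_2_eq_2)
    then have "(Suc (h (?r v) div 2) + t) mod l = (h v div 2 + t) mod l"
      by (metis mod_add_left_eq)
    then show ?thesis by (simp add: mod_Suc_eq)
  qed
  have near: "\<exists>i\<le>q - 1. (parent D ^^ i) v \<in> ?Q" if "v \<in> U" for v
  proof -
    have "(?r ^^ (?x v mod m)) v \<in> ?Q"
      using descent_to_multiple[of U ?r ?x l v m] closed step that \<open>l > 0\<close> by simp
    then have "(parent D ^^ (2 * (?x v mod m))) v \<in> ?Q"
      by (simp add: funpow_mult mult.commute)
    moreover have "?x v mod m < m" using \<open>q + 1 = 2 * m\<close> by (intro mod_less_divisor) linarith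
    then have "2 * (?x v mod m) \<le> q - 1" using \<open>q + 1 = 2 * m\<close> by linarith
    ultimately show ?thesis by blast
  qed
  fix v assume v: "v \<in> verts D"
  show "\<exists>i\<le>q. (parent D ^^ i) v \<in> ?Q"
  proof (cases "v \<in> U")
    case True
    then show ?thesis using near[of v] by (meson diff_le_self le_trans)
  next
    case False
    then have "parent D v \<in> U" using parent_other_side[OF D UV v] v verts by blast
    from near[OF this] obtain i where "i \<le> q - 1" "(parent D ^^ i) (parent D v) \<in> ?Q" by blast
    then have "(parent D ^^ Suc i) v \<in> ?Q" "Suc i \<le> q"
      using \<open>q > 0\<close> by (auto simp: funpow_swap1)
    then show ?thesis by blast
  qed
qed

lemma small_q_kernel_in_side:
  assumes D: "unicyclic D" and c: "pre_digraph.cycle D c" "length c = 2 * l"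
    and UV: "bipartition D U V" and "odd q"
  shows "\<exists>Q\<subseteq>U. q_kernel D q Q \<and>
    real (card Q) \<le> 2 * (of_int \<lceil>real l / (real q + 1)\<rceil> / real l) * real (card U)"
proof -
  have "l > 0" using c by (cases l) (auto simp: pre_digraph.cycle_def)
  from \<open>odd q\<close> have "even (q + 1)" by simp
  then obtain m where m: "q + 1 = 2 * m" by (elim evenE)
  define k where "k = nat \<lceil>real l / (real q + 1)\<rceil>"
  have "0 \<le> \<lceil>real l / (real q + 1)\<rceil>" by (simp add: zero_le_ceiling less_le_trans[of _ 0])
  then have k: "real k = of_int \<lceil>real l / (real q + 1)\<rceil>" by (simp add: k_def)
  have "real l / (real q + 1) \<le> real k" unfolding k by (rule le_of_int_ceiling)
  then have "real l \<le> real (k * (q + 1))" by (simp add: pos_divide_le_eq add_pos_nonneg algebra_simps)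
  then have "l \<le> k * (q + 1)" by (simp only: of_nat_le_iff)
  then have "l \<le> 2 * m * k" unfolding m by (simp add: mult.commute)
  obtain h where h: "\<And>v. v \<in> verts D \<Longrightarrow> Suc (h (parent D v)) mod (2 * l) = h v mod (2 * l)"
    using parent_level[OF D c(1)] unfolding c(2) by blast
  have "finite U" using unicyclic_finite[OF D] UV by (simp add: bipartition_def)
  obtain t where t: "l * card {v \<in> U. m dvd (h v div 2 + t) mod l} \<le> 2 * k * card U"
    using small_residue_class[OF \<open>finite U\<close> \<open>l > 0\<close> \<open>l \<le> 2 * m * k\<close>] .
  let ?Q = "{v \<in> U. m dvd (h v div 2 + t) mod l}"
  have "real (l * card ?Q) \<le> real (2 * k * card U)" using t by (simp only: of_nat_le_iff)
  then have "real (card ?Q) \<le> 2 * (real k / real l) * real (card U)"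
    using \<open>l > 0\<close> by (simp add: field_simps)
  moreover have "q_kernel D q ?Q"
    by (rule residue_class_is_q_kernel[OF D UV \<open>l > 0\<close> m]) (rule h)
  moreover have "?Q \<subseteq> U" by blast
  ultimately show ?thesis unfolding k by blast
qed

theorem theorem1p8:
  fixes D :: "('a, 'b) pre_digraph" and U V :: "'a set" and l q :: nat
  assumes "unicyclic D"
    and "\<exists>c. pre_digraph.cycle D c \<and> length c = 2 * l"
    and "bipartition D U V"
    and "q \<ge> 3" and "odd q"
  shows "\<exists>Q\<^sub>U Q\<^sub>V. Q\<^sub>U \<subseteq> U \<and> Q\<^sub>V \<subseteq> V \<and> q_kernel D q Q\<^sub>U \<and> q_kernel D q Q\<^sub>V \<and>
    real (card Q\<^sub>U) + real (card Q\<^sub>V)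
      \<le> 2 * (of_int \<lceil>real l / (real q + 1)\<rceil> / real l) * real (card (verts D))"
proof -
  let ?r = "2 * (of_int \<lceil>real l / (real q + 1)\<rceil> / real l) :: real"
  from assms(2) obtain c where c: "pre_digraph.cycle D c" "length c = 2 * l" by blast
  obtain Q\<^sub>U where U: "Q\<^sub>U \<subseteq> U" "q_kernel D q Q\<^sub>U" "real (card Q\<^sub>U) \<le> ?r * real (card U)"
    using small_q_kernel_in_side[OF assms(1) c assms(3,5)] by blast
  obtain Q\<^sub>V where V: "Q\<^sub>V \<subseteq> V" "q_kernel D q Q\<^sub>V" "real (card Q\<^sub>V) \<le> ?r * real (card V)"
    using small_q_kernel_in_side[OF assms(1) c bipartition_sym[OF assms(3)] assms(5)] by blast
  have "card (verts D) = card U + card V"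
    using unicyclic_finite[OF assms(1)] assms(3) by (simp add: bipartition_def card_Un_disjoint)
  then have "real (card Q\<^sub>U) + real (card Q\<^sub>V) \<le> ?r * real (card (verts D))"
    using U(3) V(3) by (simp add: distrib_left)
  then show ?thesis using U V by blast
qed

end
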